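(* Let $m,l,n$ be positive integers, and let $\mathcal{A}$ be an $m\times l$ matrix and $\mathcal{B}$ an $l\times n$ matrix with entries in a commutative ring $R$. Then $$\mathcal{A}\,\mathcal{B}=\sum_{k=0}^{l-1}\bigl(\epsilon^k_{m\times n}(\sigma(\mathcal{A}))\bigr)\odot\bigl(\omega^k_{m\times n}(\tau(\mathcal{B}))\bigr),$$ where the left-hand side is the ordinary matrix product (an $m\times n$ matrix).
   Context: All matrix indices start at $0$, and $[x]_y$ denotes $x \bmod y\in\{0,\dots,y-1\}$. $\odot$ denotes the element-wise (Hadamard) product of two matrices of the same size. The operators are defined as follows. For an $m\times l$ matrix $\mathcal{A}$: $\sigma(\mathcal{A})$ is the $m\times l$ matrix with $\sigma(\mathcal{A})_{i,j}=\mathcal{A}_{i,[i+j]_l}$ for $0\le i<m$, $0\le j<l$. For an $l\times n$ matrix $\mathcal{B}$: $\tau(\mathcal{B})$ is the $l\times n$ matrix with $\tau(\mathcal{B})_{i,j}=\mathcal{B}_{[i+j]_l,j}$ for $0\le i<l$, $0\le j<n$. For an $m\times l$ matrix $\mathcal{A}$ and an integer $k\ge 0$: $\epsilon^k_{m\times n}(\mathcal{A})$ is the $m\times n$ matrix with $\epsilon^k_{m\times n}(\mathcal{A})_{i,j}=\mathcal{A}_{i,[j+k]_l}$ for $0\le i<m$, $0\le j<n$. For an $l\times n$ matrix $\mathcal{B}$ and an integer $k\ge 0$: $\omega^k_{m\times n}(\mathcal{B})$ is the $m\times n$ matrix with $\omega^k_{m\times n}(\mathcal{B})_{i,j}=\mathcal{B}_{[i+k]_l,j}$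 for $0\le i<m$, $0\le j<n$. *)

theory Defs
  imports "Jordan_Normal_Form.Matrix"
begin

definition sigma_mat :: "'a mat \<Rightarrow> 'a mat" where
  "sigma_mat A = mat (dim_row A) (dim_col A) (\<lambda>(i, j). A $$ (i, (i + j) mod dim_col A))"

definition tau_mat :: "'a mat \<Rightarrow> 'a mat" where
  "tau_mat B = mat (dim_row B) (dim_col B) (\<lambda>(i, j). B $$ ((i + j) mod dim_row B, j))"

definition epsilon_mat :: "nat \<Rightarrow> nat \<Rightarrow> nat \<Rightarrow> 'a mat \<Rightarrow> 'a mat" where
  "epsilon_mat m n k A = mat m n (\<lambda>(i, j). A $$ (i, (j + k) mod dim_col A))"

definition omega_mat :: "nat \<Rightarrow> nat \<Rightarrow> nat \<Rightarrow> 'a mat \<Rightarrow> 'a mat" where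
  "omega_mat m n k B = mat m n (\<lambda>(i, j). B $$ ((i + k) mod dim_row B, j))"

(* Only meaningful when both arguments have the same size. *)
definition hadamard_mat :: "'a::times mat \<Rightarrow> 'a mat \<Rightarrow> 'a mat" (infixl "\<odot>\<^sub>m" 70) where
  "A \<odot>\<^sub>m B = mat (dim_row A) (dim_col A) (\<lambda>(i, j). A $$ (i, j) * B $$ (i, j))"

(* The type of matrices contains all sizes, hence has no single zero and is not an
   instance of comm_monoid_add, so the overloaded sum does not apply to it.
   monoid_mat is the monoid of m x n matrices under addition, which makes its
   finprod the sum of matrices. *)
definition msum :: "nat \<Rightarrow> nat \<Rightarrow> ('b \<Rightarrow> 'a::comm_monoid_add mat) \<Rightarrow> 'b set \<Rightarrow> 'a mat" where
  "msum m n f K = finprod (monoid_mat TYPE('a) m n) f K"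

end

theory Submission
  imports Defs "HOL-Number_Theory.Cong"
begin

text \<open>
  The \<open>(i, j)\<close> entry of the \<open>k\<close>-th summand is \<open>A (i, r) * B (r, j)\<close> with \<open>r = (i + j + k) mod l\<close>.
  For fixed \<open>i\<close> and \<open>j\<close>, the residue \<open>r\<close> runs through every inner index exactly once as
  \<open>k\<close> does, so the entrywise sum is a cyclic rearrangement of the usual product formula.
\<close>

text \<open>Makes \<open>msum\<close> accessible entry by entry. Induction on \<open>K\<close>
  splits off one summand at a time; membership in the carrier is what \<open>finprod_insert\<close>
  requires of the summands.\<close>

lemma msum_mat:
  fixes f :: "'b \<Rightarrow> 'a::comm_monoid_add mat"
  assumes "finite K" and "\<And>k. k \<in> K \<Longrightarrow> f k \<in> carrier_mat m n"
  shows "msum m n f K = mat m n (\<lambda>(i, j). \<Sum>k\<in>K. f k $$ (i, j))"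
  using assms
proof (induction K rule: finite_induct)
  case empty
  interpret comm_monoid "monoid_mat TYPE('a) m n" by (rule comm_monoid_mat)
  show ?case unfolding msum_def finprod_empty by (auto simp: monoid_mat_def)
next
  case (insert x K)
  interpret comm_monoid "monoid_mat TYPE('a) m n" by (rule comm_monoid_mat)
  have "msum m n f (insert x K) = f x + msum m n f K"
    using insert unfolding msum_def by (subst finprod_insert) (auto simp: monoid_mat_def)
  also have "\<dots> = mat m n (\<lambda>(i, j). \<Sum>k\<in>insert x K. f k $$ (i, j))"
    using insert by (intro eq_matI) auto
  finally show ?case .
qed

text \<open>Translation by \<open>c\<close> is injective on residues by cancellation, hence a
  permutation of the finite set \<open>{..<l}\<close>, and the sum is only reindexed.\<close>

lemma sum_mod_shift:
  fixes f :: "nat \<Rightarrow> 'a::comm_monoid_add"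
  assumes "0 < l"
  shows "(\<Sum>k<l. f ((c + k) mod l)) = (\<Sum>k<l. f k)"
proof -
  have "inj_on (\<lambda>k. (c + k) mod l) {..<l}"
  proof (rule inj_onI)
    fix x y assume "x \<in> {..<l}" "y \<in> {..<l}" "(c + x) mod l = (c + y) mod l"
    then show "x = y"
      by (metis cong_add_lcancel_nat cong_def lessThan_iff mod_less)
  qed
  moreover have "(\<lambda>k. (c + k) mod l) ` {..<l} \<subseteq> {..<l}"
    using assms by auto
  ultimately have "bij_betw (\<lambda>k. (c + k) mod l) {..<l} {..<l}"
    by (simp add: bij_betw_def endo_inj_surj)
  then show ?thesis by (rule sum.reindex_bij_betw)
qed

theorem mainTheorem1:
  fixes A B :: "'a::comm_ring mat" and m l n :: nat
  assumes "0 < m" and "0 < l" and "0 < n"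
    and "A \<in> carrier_mat m l" and "B \<in> carrier_mat l n"
  shows "A * B = msum m n
    (\<lambda>k. epsilon_mat m n k (sigma_mat A) \<odot>\<^sub>m omega_mat m n k (tau_mat B)) {0..<l}"
proof (rule eq_matI)
  let ?F = "\<lambda>k. epsilon_mat m n k (sigma_mat A) \<odot>\<^sub>m omega_mat m n k (tau_mat B)"
  \<comment> \<open>The Hadamard product takes its size from its left factor.\<close>
  have F: "?F k \<in> carrier_mat m n" for k
    by (simp add: hadamard_mat_def epsilon_mat_def)
  note msum = msum_mat[of "{0..<l}" ?F m n, OF finite_atLeastLessThan F]
  show "dim_row (A * B) = dim_row (msum m n ?F {0..<l})"
    "dim_col (A * B) = dim_col (msum m n ?F {0..<l})"
    using assms by (simp_all add: msum)
  fix i j assume "i < dim_row (msum m n ?F {0..<l})" "j < dim_col (msum m n ?F {0..<l})"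
  then have i: "i < m" and j: "j < n" by (simp_all add: msum)
  have entry: "?F k $$ (i, j) = A $$ (i, (i + j + k) mod l) * B $$ ((i + j + k) mod l, j)" for k
  proof -
    \<comment> \<open>The first nested residue is the column index into \<open>A\<close>
      (\<open>sigma_mat\<close> after the column shift), the second the row index into
      \<open>B\<close> (\<open>tau_mat\<close> after the row shift).\<close>
    have "(i + (j + k) mod l) mod l = (i + j + k) mod l"
      "((i + k) mod l + j) mod l = (i + j + k) mod l"
      by (simp_all add: mod_simps ac_simps)
    then show ?thesis
      \<comment> \<open>\<open>0 < l\<close> keeps the inner residues below \<open>l\<close>, so the
        entries of \<open>sigma_mat A\<close> and \<open>tau_mat B\<close> are read within
        range.\<close>
      using assms i j
      by (simp add: hadamard_mat_def epsilon_mat_def omega_mat_def sigma_mat_def tau_mat_def)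
  qed
  have "(A * B) $$ (i, j) = (\<Sum>k<l. A $$ (i, k) * B $$ (k, j))"
    using assms i j by (simp add: scalar_prod_def atLeast0LessThan)
  \<comment> \<open>The shift is \<open>c = i + j\<close>, constant in \<open>k\<close>.\<close>
  also have "\<dots> = (\<Sum>k<l. A $$ (i, (i + j + k) mod l) * B $$ ((i + j + k) mod l, j))"
    by (rule sum_mod_shift[OF assms(2), symmetric])
  also have "\<dots> = msum m n ?F {0..<l} $$ (i, j)"
    using i j by (simp add: msum entry flip: atLeast0LessThan)
  finally show "(A * B) $$ (i, j) = msum m n ?F {0..<l} $$ (i, j)" .
qed

end
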